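(* Let $R_w$ be the $5$-ary Boolean relation $R_w(x_1,x_2,x_3,x_4,c_0)\equiv(x_1\leftrightarrow x_2\wedge x_3)\wedge(x_2\vee x_3\to x_4)\wedge(c_0=0)$. Then $\langle R_w\rangle_{\exists!}\subsetneq\mathrm{IE}_0$.
   Context: $\mathrm{IE}_0=\mathrm{Inv}(\{\wedge,0\})$ is the set of Boolean relations preserved (under coordinatewise application) by binary conjunction $\wedge$ and by the constant operation $0$; it equals $\langle R_w\rangle$. A upp-definition of an $n$-ary relation $R$ over $\Gamma$ is a formula $R(x_1,\dots,x_n)\equiv\exists y_1,\dots,y_m\colon R_1(\mathbf{x}_1)\wedge\dots\wedge R_k(\mathbf{x}_k)$ with each $R_j\in\Gamma\cup\{\mathrm{Eq}\}$ (equality relation), $\mathbf{x}_j$ tuples of variables among $x_1,\dots,x_n,y_1,\dots,y_m$, such that each $y_j$ is uniquely determined by $x_1,\dots,x_n$ (a function of their values in every satisfying assignment of the conjunction). $\langle\Gamma\rangle_{\exists!}$ is the set of relations upp-definable over $\Gamma$. *)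

theory Defs
  imports Main
begin

text \<open>A Boolean relation carries its arity explicitly, so that empty relations of different
  arities are distinct; tuples are lists, with \<^term>\<open>False\<close> for 0 and \<^term>\<open>True\<close> for 1.\<close>

type_synonym brel = "nat \<times> bool list set"

definition is_brel :: "brel \<Rightarrow> bool" where
  "is_brel R \<longleftrightarrow> fst R \<ge> 1 \<and> (\<forall>t \<in> snd R. length t = fst R)"

text \<open>A \<open>k\<close>-ary operation is a pair of \<open>k\<close> and a function that is only applied to lists of
  length \<open>k\<close>.\<close>

type_synonym bop = "nat \<times> (bool list \<Rightarrow> bool)"

definition apply_coordwise :: "bop \<Rightarrow> nat \<Rightarrow> bool list list \<Rightarrow> bool list" where
  "apply_coordwise f n ts = map (\<lambda>i. snd f (map (\<lambda>t. t ! i) ts)) [0..<n]"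

definition preserves :: "bop \<Rightarrow> brel \<Rightarrow> bool" where
  "preserves f R \<longleftrightarrow>
     (\<forall>ts. length ts = fst f \<and> set ts \<subseteq> snd R \<longrightarrow> apply_coordwise f (fst R) ts \<in> snd R)"

definition Inv :: "bop set \<Rightarrow> brel set" where
  "Inv F = {R. is_brel R \<and> (\<forall>f \<in> F. preserves f R)}"

definition and_op :: bop where
  "and_op = (2, \<lambda>as. as ! 0 \<and> as ! 1)"

text \<open>The constant 0 is nullary: a relation is preserved by it iff it contains the all-zero
  tuple. A unary constant would also admit the empty relations, which are not even
  primitive positive definable from relations containing the all-zero tuple.\<close>

definition zero_op :: bop where
  "zero_op = (0, \<lambda>_. False)"

definition IE0 :: "brel set" where
  "IE0 = Inv {and_op, zero_op}"

definition Eq_rel :: brel where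
  "Eq_rel = (2, {[a, b] | a b. a = b})"

text \<open>An atom is a relation applied to a tuple of variables. In a formula with free variables
  \<open>x\<^sub>1, \<dots>, x\<^sub>n\<close> and quantified variables \<open>y\<^sub>1, \<dots>, y\<^sub>m\<close>, the variable \<open>x\<^sub>i\<close> has index \<open>i - 1\<close>
  and \<open>y\<^sub>j\<close> has index \<open>n + j - 1\<close>; an assignment is the list of values \<open>xs @ ys\<close>.\<close>

type_synonym atom = "brel \<times> nat list"

definition wf_atom :: "brel set \<Rightarrow> nat \<Rightarrow> atom \<Rightarrow> bool" where
  "wf_atom \<Gamma> N A \<longleftrightarrow>
     fst A \<in> \<Gamma> \<union> {Eq_rel} \<and> length (snd A) = fst (fst A) \<and> (\<forall>v \<in> set (snd A). v < N)"

definition sat :: "bool list \<Rightarrow> atom list \<Rightarrow> bool" where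
  "sat as \<Phi> \<longleftrightarrow> (\<forall>A \<in> set \<Phi>. map (\<lambda>v. as ! v) (snd A) \<in> snd (fst A))"

definition upp_definition :: "brel set \<Rightarrow> nat \<Rightarrow> atom list \<Rightarrow> brel \<Rightarrow> bool" where
  "upp_definition \<Gamma> m \<Phi> R \<longleftrightarrow>
     (\<forall>A \<in> set \<Phi>. wf_atom \<Gamma> (fst R + m) A) \<and>
     snd R = {xs. length xs = fst R \<and> (\<exists>ys. length ys = m \<and> sat (xs @ ys) \<Phi>)} \<and>
     (\<forall>j < m. \<exists>f :: bool list \<Rightarrow> bool. \<forall>xs ys.
        length xs = fst R \<and> length ys = m \<and> sat (xs @ ys) \<Phi> \<longrightarrow> ys ! j = f xs)"

definition upp_closure :: "brel set \<Rightarrow> brel set" where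
  "upp_closure \<Gamma> = {R. is_brel R \<and> (\<exists>m \<Phi>. upp_definition \<Gamma> m \<Phi> R)}"

definition R_w :: brel where
  "R_w = (5, {[x1, x2, x3, x4, c0] | x1 x2 x3 x4 c0.
     (x1 \<longleftrightarrow> x2 \<and> x3) \<and> (x2 \<or> x3 \<longrightarrow> x4) \<and> c0 = False})"

end

theory Submission
  imports Defs
begin

text \<open>If \<open>g\<close> and \<open>h\<close> are polymorphisms of \<open>\<Gamma>\<close>, and a partial operation \<open>f\<close> with domain \<open>g = h\<close>
  preserves \<open>\<Gamma>\<close>, then \<open>f\<close> preserves every upp-definable relation: when the free variables of some
  satisfying assignments lie in the domain of \<open>f\<close>, applying \<open>g\<close> and \<open>h\<close> to these assignments gives
  satisfying assignments that agree on the free variables, hence everywhere, so the quantified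
  variables lie in the domain as well. For \<open>R\<^sub>w\<close> this applies to disjunction restricted to disjoint
  pairs, the equalizer of conjunction and 0: an atom of \<open>R\<^sub>w\<close> could only fail if \<open>x\<^sub>2\<close> is 1 in one
  tuple and \<open>x\<^sub>3\<close> in the other, but then \<open>x\<^sub>4\<close> is 1 in both. The relation \<open>x\<^sub>1 \<longleftrightarrow> x\<^sub>2 \<and> x\<^sub>3\<close> is in
  \<open>IE\<^sub>0\<close>, but is not preserved: it contains 010 and 001 but not 011.\<close>

definition preserves_on :: "bool list set \<Rightarrow> bop \<Rightarrow> brel \<Rightarrow> bool" where
  "preserves_on D f R \<longleftrightarrow>
     (\<forall>ts. length ts = fst f \<and> set ts \<subseteq> snd R \<and> (\<forall>i < fst R. map (\<lambda>t. t ! i) ts \<in> D) \<longrightarrow>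
        apply_coordwise f (fst R) ts \<in> snd R)"

lemma preserves_on_UNIV: "preserves_on UNIV f R \<longleftrightarrow> preserves f R"
  by (simp add: preserves_on_def preserves_def)

lemma preserves_on_binary_iff:
  "preserves_on D (2, f) R \<longleftrightarrow>
     (\<forall>s \<in> snd R. \<forall>t \<in> snd R. (\<forall>i < fst R. [s ! i, t ! i] \<in> D) \<longrightarrow>
        map (\<lambda>i. f [s ! i, t ! i]) [0..<fst R] \<in> snd R)"
proof -
  have "(\<forall>ts. length ts = 2 \<longrightarrow> P ts) \<longleftrightarrow> (\<forall>s t. P [s, t])" for P :: "bool list list \<Rightarrow> bool"
    by (auto simp: length_Suc_conv numeral_2_eq_2)
  then show ?thesis
    by (auto simp: preserves_on_def apply_coordwise_def imp_conjL)
qed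

lemma preserves_on_Eq_rel: "preserves_on D f Eq_rel"
  unfolding preserves_on_def
proof (intro allI impI, elim conjE)
  fix ts assume "set ts \<subseteq> snd Eq_rel"
  then have "map (\<lambda>t. t ! 0) ts = map (\<lambda>t. t ! 1) ts"
    by (auto simp: Eq_rel_def)
  then have "snd f (map (\<lambda>t. t ! 0) ts) = snd f (map (\<lambda>t. t ! 1) ts)"
    by (rule arg_cong)
  then show "apply_coordwise f (fst Eq_rel) ts \<in> snd Eq_rel"
    by (simp add: apply_coordwise_def Eq_rel_def numeral_2_eq_2)
qed

lemma preserves_constant_of_nullary:
  assumes "preserves (0, \<lambda>_. c) R"
  shows "preserves (k, \<lambda>_. c) R"
  using assms by (simp add: preserves_def apply_coordwise_def)

lemma take_apply_coordwise:
  assumes "n \<le> N"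
  shows "take n (apply_coordwise f N ts) = apply_coordwise f n (map (take n) ts)"
  using assms by (simp add: apply_coordwise_def take_map o_def)

definition solutions :: "nat \<Rightarrow> atom list \<Rightarrow> bool list set" where
  "solutions N \<Phi> = {as. length as = N \<and> sat as \<Phi>}"

lemma apply_coordwise_in_solutions:
  assumes wf: "\<forall>A \<in> set \<Phi>. wf_atom \<Gamma> N A"
    and preserves: "\<forall>R \<in> \<Gamma>. preserves_on D f R"
    and ts: "length ts = fst f" "set ts \<subseteq> solutions N \<Phi>"
    and dom: "\<forall>i < N. map (\<lambda>t. t ! i) ts \<in> D"
  shows "apply_coordwise f N ts \<in> solutions N \<Phi>"
proof -
  have "map ((!) (apply_coordwise f N ts)) vs \<in> snd R" if "(R, vs) \<in> set \<Phi>" for R vs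
  proof -
    have R: "R \<in> \<Gamma> \<union> {Eq_rel}" and vs: "length vs = fst R" "\<forall>v \<in> set vs. v < N"
      using wf that by (auto simp: wf_atom_def)
    define us where "us = map (\<lambda>t. map ((!) t) vs) ts"
    have "preserves_on D f R"
      using R preserves preserves_on_Eq_rel by blast
    moreover have "set us \<subseteq> snd R"
      using ts that by (fastforce simp: us_def solutions_def sat_def)
    moreover have "\<forall>i < fst R. map (\<lambda>u. u ! i) us \<in> D"
      using dom vs by (simp add: us_def o_def)
    ultimately have "apply_coordwise f (fst R) us \<in> snd R"
      using ts by (simp add: preserves_on_def us_def)
    moreover have "apply_coordwise f (fst R) us = map ((!) (apply_coordwise f N ts)) vs"
      using vs by (intro nth_equalityI) (simp_all add: apply_coordwise_def us_def o_def)
    ultimately show ?thesis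
      by simp
  qed
  then show ?thesis
    by (auto simp: solutions_def sat_def apply_coordwise_def)
qed

lemma in_solutions_add_iff:
  "as \<in> solutions (n + m) \<Phi> \<longleftrightarrow>
     length (take n as) = n \<and> length (drop n as) = m \<and> sat (take n as @ drop n as) \<Phi>"
  by (auto simp: solutions_def)

lemma upp_definition_eq_take_image:
  assumes "upp_definition \<Gamma> m \<Phi> R"
  shows "snd R = take (fst R) ` solutions (fst R + m) \<Phi>"
proof -
  have R: "snd R = {xs. length xs = fst R \<and> (\<exists>ys. length ys = m \<and> sat (xs @ ys) \<Phi>)}"
    using assms by (simp add: upp_definition_def)
  show ?thesis
  proof (intro equalityI subsetI)
    fix xs assume "xs \<in> snd R"
    then obtain ys where "length xs = fst R" "length ys = m" "sat (xs @ ys) \<Phi>"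
      by (auto simp: R)
    then show "xs \<in> take (fst R) ` solutions (fst R + m) \<Phi>"
      by (intro image_eqI[of _ _ "xs @ ys"]) (simp_all add: solutions_def)
  next
    fix xs assume "xs \<in> take (fst R) ` solutions (fst R + m) \<Phi>"
    then obtain as where "xs = take (fst R) as" "as \<in> solutions (fst R + m) \<Phi>"
      by blast
    then show "xs \<in> snd R"
      unfolding R in_solutions_add_iff by blast
  qed
qed

lemma upp_definition_inj_on_take:
  assumes "upp_definition \<Gamma> m \<Phi> R"
  shows "inj_on (take (fst R)) (solutions (fst R + m) \<Phi>)"
proof (rule inj_onI)
  let ?n = "fst R"
  fix s t
  assume st: "s \<in> solutions (?n + m) \<Phi>" "t \<in> solutions (?n + m) \<Phi>"
    and take: "take ?n s = take ?n t"
  have "drop ?n s ! j = drop ?n t ! j" if j: "j < m" for j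
  proof -
    obtain f :: "bool list \<Rightarrow> bool" where f: "\<forall>xs ys.
        length xs = ?n \<and> length ys = m \<and> sat (xs @ ys) \<Phi> \<longrightarrow> ys ! j = f xs"
      using assms j unfolding upp_definition_def by blast
    have "drop ?n s ! j = f (take ?n s)" "drop ?n t ! j = f (take ?n t)"
      using st unfolding in_solutions_add_iff by (simp_all add: f)
    with take show ?thesis
      by simp
  qed
  then have "drop ?n s = drop ?n t"
    using st unfolding in_solutions_add_iff by (simp add: list_eq_iff_nth_eq)
  with take show "s = t"
    by (metis append_take_drop_id)
qed

lemma preserves_on_equalizer_upp_closure:
  assumes "R \<in> upp_closure \<Gamma>"
    and g: "\<forall>S \<in> \<Gamma>. preserves (k, g) S" and h: "\<forall>S \<in> \<Gamma>. preserves (k, h) S"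
    and f: "\<forall>S \<in> \<Gamma>. preserves_on {as. g as = h as} (k, f) S"
  shows "preserves_on {as. g as = h as} (k, f) R"
proof -
  let ?n = "fst R"
  obtain m \<Phi> where upp: "upp_definition \<Gamma> m \<Phi> R"
    using assms(1) by (auto simp: upp_closure_def)
  define N where "N = ?n + m"
  have wf: "\<forall>A \<in> set \<Phi>. wf_atom \<Gamma> N A" and "?n \<le> N"
    using upp by (simp_all add: upp_definition_def N_def)
  note R = upp_definition_eq_take_image[OF upp, folded N_def]
  note inj = upp_definition_inj_on_take[OF upp, folded N_def]
  note take = take_apply_coordwise[OF \<open>?n \<le> N\<close>]
  have "apply_coordwise (k, f) ?n ts \<in> snd R"
    if ts: "length ts = k" "set ts \<subseteq> snd R"
      and eq: "\<forall>i < ?n. g (map (\<lambda>t. t ! i) ts) = h (map (\<lambda>t. t ! i) ts)" for ts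
  proof -
    have "ts \<in> map (take ?n) ` lists (solutions N \<Phi>)"
      using ts(2) by (simp add: R in_lists_conv_set subset_iff flip: lists_image)
    then obtain us where us: "ts = map (take ?n) us" "set us \<subseteq> solutions N \<Phi>"
      by auto
    have "length us = k"
      using ts us by simp
    then have solution: "apply_coordwise (k, g) N us \<in> solutions N \<Phi>"
      "apply_coordwise (k, h) N us \<in> solutions N \<Phi>"
      using apply_coordwise_in_solutions[OF wf, of UNIV] g h us(2)
      by (simp_all add: preserves_on_UNIV)
    have "apply_coordwise (k, g) ?n ts = apply_coordwise (k, h) ?n ts"
      using eq by (simp add: apply_coordwise_def)
    then have "apply_coordwise (k, g) N us = apply_coordwise (k, h) N us"
      using inj_onD[OF inj _ solution] us(1) by (simp add: take)
    then have "\<forall>i < N. map (\<lambda>u. u ! i) us \<in> {as. g as = h as}"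
      by (simp add: apply_coordwise_def)
    then have "apply_coordwise (k, f) N us \<in> solutions N \<Phi>"
      using apply_coordwise_in_solutions[OF wf f] \<open>length us = k\<close> us(2) by simp
    then have "take ?n (apply_coordwise (k, f) N us) \<in> snd R"
      unfolding R by (rule imageI)
    then show ?thesis
      by (simp add: take us(1))
  qed
  then show ?thesis
    by (simp add: preserves_on_def)
qed

text \<open>A total operation \<open>f\<close> is covered by the case \<open>g = h = f\<close>, whose equalizer is everything.\<close>

lemma upp_closure_subset_Inv:
  assumes "\<Gamma> \<subseteq> Inv F"
  shows "upp_closure \<Gamma> \<subseteq> Inv F"
proof
  fix R assume R: "R \<in> upp_closure \<Gamma>"
  have "preserves (k, f) R" if "(k, f) \<in> F" for k f
  proof -
    have "\<forall>S \<in> \<Gamma>. preserves (k, f) S"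
      using assms that by (auto simp: Inv_def)
    then show ?thesis
      using preserves_on_equalizer_upp_closure[OF R, of k f f f] by (simp add: preserves_on_UNIV)
  qed
  then show "R \<in> Inv F"
    using R by (auto simp: Inv_def upp_closure_def)
qed

lemma preserves_zero_op_iff: "preserves zero_op R \<longleftrightarrow> replicate (fst R) False \<in> snd R"
  by (simp add: preserves_def zero_op_def apply_coordwise_def map_replicate_const)

lemma preserves_and_op_iff:
  "preserves and_op R \<longleftrightarrow>
     (\<forall>s \<in> snd R. \<forall>t \<in> snd R. map (\<lambda>i. s ! i \<and> t ! i) [0..<fst R] \<in> snd R)"
  by (simp add: and_op_def preserves_on_binary_iff flip: preserves_on_UNIV)

definition disjoint_pairs :: "bool list set" where
  "disjoint_pairs = {as. \<not> (as ! 0 \<and> as ! 1)}"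

definition or_op :: bop where
  "or_op = (2, \<lambda>as. as ! 0 \<or> as ! 1)"

lemma preserves_on_disjoint_pairs_or_op_iff:
  "preserves_on disjoint_pairs or_op R \<longleftrightarrow>
     (\<forall>s \<in> snd R. \<forall>t \<in> snd R. (\<forall>i < fst R. \<not> (s ! i \<and> t ! i)) \<longrightarrow>
        map (\<lambda>i. s ! i \<or> t ! i) [0..<fst R] \<in> snd R)"
  by (simp add: disjoint_pairs_def or_op_def preserves_on_binary_iff)

lemma upp_closure_preserves_disjoint_or:
  assumes "\<Gamma> \<subseteq> IE0" "\<forall>S \<in> \<Gamma>. preserves_on disjoint_pairs or_op S" "R \<in> upp_closure \<Gamma>"
  shows "preserves_on disjoint_pairs or_op R"
proof -
  have conj: "\<forall>S \<in> \<Gamma>. preserves (2, \<lambda>as. as ! 0 \<and> as ! 1) S"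
    using assms(1) by (auto simp: IE0_def Inv_def and_op_def)
  have zero: "\<forall>S \<in> \<Gamma>. preserves (2, \<lambda>_. False) S"
    using assms(1) by (auto simp: IE0_def Inv_def zero_op_def intro: preserves_constant_of_nullary)
  show ?thesis
    using preserves_on_equalizer_upp_closure[OF assms(3) conj zero] assms(2)
    by (simp add: disjoint_pairs_def or_op_def)
qed

lemma R_w_in_IE0: "R_w \<in> IE0"
  by (auto simp: IE0_def Inv_def is_brel_def preserves_zero_op_iff preserves_and_op_iff R_w_def
      numeral_eq_Suc)

lemma R_w_preserves_disjoint_or: "preserves_on disjoint_pairs or_op R_w"
  unfolding preserves_on_disjoint_pairs_or_op_iff
proof (intro ballI impI)
  fix s t assume "s \<in> snd R_w" "t \<in> snd R_w" and disjoint: "\<forall>i < fst R_w. \<not> (s ! i \<and> t ! i)"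
  then obtain a b c d a' b' c' d' where
    s: "s = [a, b, c, d, False]" "a \<longleftrightarrow> b \<and> c" "b \<or> c \<longrightarrow> d" and
    t: "t = [a', b', c', d', False]" "a' \<longleftrightarrow> b' \<and> c'" "b' \<or> c' \<longrightarrow> d'"
    unfolding R_w_def snd_conv mem_Collect_eq by blast
  have "\<not> (d \<and> d')"
    using disjoint[rule_format, of 3] s(1) t(1) by (simp add: R_w_def)
  then have "a \<or> a' \<longleftrightarrow> (b \<or> b') \<and> (c \<or> c')" "(b \<or> b') \<or> (c \<or> c') \<longrightarrow> d \<or> d'"
    using s t by blast+
  then show "map (\<lambda>i. s ! i \<or> t ! i) [0..<fst R_w] \<in> snd R_w"
    by (auto simp: R_w_def s(1) t(1) numeral_eq_Suc)
qed

definition conj_graph :: brel where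
  "conj_graph = (3, {[b \<and> c, b, c] | b c. True})"

lemma conj_graph_in_IE0: "conj_graph \<in> IE0"
  by (auto simp: IE0_def Inv_def is_brel_def preserves_zero_op_iff preserves_and_op_iff
      conj_graph_def numeral_3_eq_3)

lemma conj_graph_not_preserves_disjoint_or: "\<not> preserves_on disjoint_pairs or_op conj_graph"
proof
  have tuples: "[False, True, False] \<in> snd conj_graph" "[False, False, True] \<in> snd conj_graph"
    by (auto simp: conj_graph_def)
  assume "preserves_on disjoint_pairs or_op conj_graph"
  moreover have "\<forall>i < fst conj_graph. \<not> ([False, True, False] ! i \<and> [False, False, True] ! i)"
    by (simp add: conj_graph_def numeral_3_eq_3 All_less_Suc)
  ultimately have "map (\<lambda>i. [False, True, False] ! i \<or> [False, False, True] ! i)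
      [0..<fst conj_graph] \<in> snd conj_graph"
    using tuples unfolding preserves_on_disjoint_pairs_or_op_iff by blast
  then show False
    by (auto simp: conj_graph_def numeral_3_eq_3)
qed

theorem theorem22: "upp_closure {R_w} \<subset> IE0"
proof
  show "upp_closure {R_w} \<subseteq> IE0"
    using R_w_in_IE0 upp_closure_subset_Inv by (simp add: IE0_def)
  have "conj_graph \<notin> upp_closure {R_w}"
    using upp_closure_preserves_disjoint_or[of "{R_w}"] R_w_in_IE0 R_w_preserves_disjoint_or
      conj_graph_not_preserves_disjoint_or by blast
  then show "upp_closure {R_w} \<noteq> IE0"
    using conj_graph_in_IE0 by blast
qed

end
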